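(* Every (sufficiently smooth) solution $F:[0,T)\times M\to\mathbb{R}^{n+1}$ of the hyperbolic mean curvature flow (HMCF) satisfies the conservation law $$\frac{d}{dt}\big(S(X)\,d\mu_t\big)=0,$$ where $X\in\Gamma(TM)$ is any time-independent vector field on $M$.
   Context: $M$ is an orientable smooth $n$-dimensional manifold and $F:[0,T)\times M\to\mathbb{R}^{n+1}$ is a smooth family of immersions. $\frac{d}{dt}$ is the time derivative at a fixed point of $M$ (also applied to time-dependent $n$-forms on $M$); in local coordinates $F_i:=\partial F/\partial x^i$; $g_{ij}:=\langle F_i,F_j\rangle$ is the induced metric, with Levi-Civita connection $\nabla$ and volume form $d\mu_t$; indices are raised with $g^{ij}$. $\nu$ is the unit normal along the hypersurface (inward pointing when $M$ is compact without boundary), $h_{ij}:=-\langle F_i,\nabla_j\nu\rangle$, $H:=g^{ij}h_{ij}$. $\sigma:=\langle\frac{dF}{dt},\nu\rangle$; $S=S_i\,dx^i$ is the tangential velocity $1$-form, $S_i:=\langle\frac{dF}{dt},F_i\rangle$; $d^\dagger S:=\nabla^iS_i$, $e:=\frac12\left(\left|\frac{dF}{dt}\right|^2+n\right)$. The equation (HMCF) is $$\frac{d^2}{dt^2}F=\big((e-|S|^2)H-\sigma\,d^\dagger S\big)\nu+\big((\sigma H-d^\dagger S)S^k-\nabla^ke\big)F_k.$$ *)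

theory Defs
  imports "HOL-Analysis.Analysis"
begin

section \<open>Differentiability classes\<close>

text \<open>
  The derivative is taken within the set, so the notion is one-sided at the boundary; it is used on
  open sets and on products of an interval with an open set, where derivatives within the
  set are unique.
\<close>

primrec Ck_on :: "nat \<Rightarrow> ('a::euclidean_space \<Rightarrow> 'b::real_normed_vector) \<Rightarrow> 'a set \<Rightarrow> bool" where
  "Ck_on 0 f S \<longleftrightarrow> continuous_on S f"
| "Ck_on (Suc k) f S \<longleftrightarrow>
     (\<exists>f'. (\<forall>x\<in>S. (f has_derivative f' x) (at x within S)) \<and>
           (\<forall>b\<in>Basis. Ck_on k (\<lambda>x. f' x b) S))"

definition smooth_on :: "('a::euclidean_space \<Rightarrow> 'b::real_normed_vector) \<Rightarrow> 'a set \<Rightarrow> bool" where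
  "smooth_on f S \<longleftrightarrow> (\<forall>k. Ck_on k f S)"


section \<open>Smooth manifolds (without boundary)\<close>

text \<open>A chart is a domain with a coordinate map; values of the map off the domain are irrelevant.\<close>

type_synonym ('m, 'n) chart = "'m set \<times> ('m \<Rightarrow> real ^ 'n)"

abbreviation domain :: "('m, 'n::finite) chart \<Rightarrow> 'm set" where
  "domain c \<equiv> fst c"

abbreviation coords :: "('m, 'n::finite) chart \<Rightarrow> 'm \<Rightarrow> real ^ 'n" where
  "coords c \<equiv> snd c"

abbreviation parametrization :: "('m, 'n::finite) chart \<Rightarrow> real ^ 'n \<Rightarrow> 'm" where
  "parametrization c \<equiv> inv_into (domain c) (coords c)"

definition is_chart :: "'m topology \<Rightarrow> ('m, 'n::finite) chart \<Rightarrow> bool" where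
  "is_chart M c \<longleftrightarrow>
     openin M (domain c) \<and> open (coords c ` domain c) \<and>
     homeomorphic_map (subtopology M (domain c)) (top_of_set (coords c ` domain c)) (coords c)"

definition transition :: "('m, 'n::finite) chart \<Rightarrow> ('m, 'n) chart \<Rightarrow> real ^ 'n \<Rightarrow> real ^ 'n" where
  "transition c d = coords d \<circ> parametrization c"

definition compatible :: "('m, 'n::finite) chart \<Rightarrow> ('m, 'n) chart \<Rightarrow> bool" where
  "compatible c d \<longleftrightarrow>
     smooth_on (transition c d) (coords c ` (domain c \<inter> domain d)) \<and>
     smooth_on (transition d c) (coords d ` (domain c \<inter> domain d))"

text \<open>The maximal atlas determined by an atlas \<open>A\<close>.\<close>

definition smooth_charts :: "'m topology \<Rightarrow> ('m, 'n::finite) chart set \<Rightarrow> ('m, 'n) chart set" where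
  "smooth_charts M A = {c. is_chart M c \<and> (\<forall>d\<in>A. compatible c d)}"

definition smooth_manifold :: "'m topology \<Rightarrow> ('m, 'n::finite) chart set \<Rightarrow> bool" where
  "smooth_manifold M A \<longleftrightarrow>
     Hausdorff_space M \<and> second_countable M \<and>
     A \<subseteq> smooth_charts M A \<and> (\<Union>c\<in>A. domain c) = topspace M"

text \<open>
  An orientation is given by an atlas of charts of the smooth structure with
  orientation-preserving transitions; a manifold is orientable iff one exists.
\<close>

definition orientation ::
    "'m topology \<Rightarrow> ('m, 'n::finite) chart set \<Rightarrow> ('m, 'n) chart set \<Rightarrow> bool" where
  "orientation M A Or \<longleftrightarrow>
     Or \<subseteq> smooth_charts M A \<and> (\<Union>c\<in>Or. domain c) = topspace M \<and>
     (\<forall>c\<in>Or. \<forall>d\<in>Or. \<forall>p\<in>domain c \<inter> domain d.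
        0 < det (matrix (frechet_derivative (transition c d) (at (coords c p)))))"

text \<open>
  A tangent vector is the family of its components with respect to all charts of the smooth
  structure around the base point, subject to the contravariant transformation law.
\<close>

type_synonym ('m, 'n) tangent = "('m, 'n) chart \<Rightarrow> real ^ 'n"

definition tangent_vector ::
    "'m topology \<Rightarrow> ('m, 'n::finite) chart set \<Rightarrow> 'm \<Rightarrow> ('m, 'n) tangent \<Rightarrow> bool" where
  "tangent_vector M A p v \<longleftrightarrow>
     (\<forall>c\<in>smooth_charts M A. \<forall>d\<in>smooth_charts M A. p \<in> domain c \<inter> domain d \<longrightarrow>
        v d = frechet_derivative (transition c d) (at (coords c p)) (v c))"

definition smooth_vector_field ::
    "'m topology \<Rightarrow> ('m, 'n::finite) chart set \<Rightarrow> ('m \<Rightarrow> ('m, 'n) tangent) \<Rightarrow> bool" where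
  "smooth_vector_field M A X \<longleftrightarrow>
     (\<forall>p\<in>topspace M. tangent_vector M A p (X p)) \<and>
     (\<forall>c\<in>smooth_charts M A. smooth_on (\<lambda>x. X (parametrization c x) c) (coords c ` domain c))"

text \<open>The coordinate derivative \<open>\<partial>f/\<partial>x\<^sup>i\<close> in the chart \<open>c\<close>, as a function on the chart domain.\<close>

definition pd ::
    "('m, 'n::finite) chart \<Rightarrow> 'n \<Rightarrow> ('m \<Rightarrow> 'b::real_normed_vector) \<Rightarrow> 'm \<Rightarrow> 'b" where
  "pd c i f p = frechet_derivative (f \<circ> parametrization c) (at (coords c p)) (axis i 1)"


section \<open>Time-dependent maps\<close>

definition time_span :: "ereal \<Rightarrow> real set" where
  "time_span T = {t. 0 \<le> t \<and> ereal t < T}"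

text \<open>Time derivative on \<open>[0,T)\<close> (one-sided at \<open>0\<close>).\<close>

definition dt :: "ereal \<Rightarrow> (real \<Rightarrow> 'b::real_normed_vector) \<Rightarrow> real \<Rightarrow> 'b" where
  "dt T f t = vector_derivative f (at t within time_span T)"

definition Ck_family ::
    "nat \<Rightarrow> 'm topology \<Rightarrow> ('m, 'n::finite) chart set \<Rightarrow> ereal \<Rightarrow>
     (real \<Rightarrow> 'm \<Rightarrow> 'b::real_normed_vector) \<Rightarrow> bool" where
  "Ck_family k M A T f \<longleftrightarrow>
     (\<forall>c\<in>smooth_charts M A.
        Ck_on k (\<lambda>(t, x). f t (parametrization c x)) (time_span T \<times> coords c ` domain c))"

definition immersions ::
    "'m topology \<Rightarrow> ('m, 'n::finite) chart set \<Rightarrow> ereal \<Rightarrow>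
     (real \<Rightarrow> 'm \<Rightarrow> real ^ 'N) \<Rightarrow> bool" where
  "immersions M A T F \<longleftrightarrow>
     (\<forall>t\<in>time_span T. \<forall>c\<in>smooth_charts M A. \<forall>p\<in>domain c.
        inj (frechet_derivative (F t \<circ> parametrization c) (at (coords c p))))"

text \<open>
  Either choice of the sign of the normal is allowed (the flow equation is invariant under
  \<open>\<nu> \<mapsto> -\<nu>\<close>), in particular the inward one when \<open>M\<close> is compact. For \<open>F\<close> of class \<open>C\<^sup>2\<close> the normal is of
  class \<open>C\<^sup>1\<close>.
\<close>

definition unit_normal ::
    "'m topology \<Rightarrow> ('m, 'n::finite) chart set \<Rightarrow> ereal \<Rightarrow>
     (real \<Rightarrow> 'm \<Rightarrow> real ^ 'N) \<Rightarrow> (real \<Rightarrow> 'm \<Rightarrow> real ^ 'N) \<Rightarrow> bool" where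
  "unit_normal M A T F \<nu> \<longleftrightarrow>
     Ck_family 1 M A T \<nu> \<and>
     (\<forall>t\<in>time_span T. \<forall>p\<in>topspace M. norm (\<nu> t p) = 1) \<and>
     (\<forall>t\<in>time_span T. \<forall>c\<in>smooth_charts M A. \<forall>p\<in>domain c. \<forall>i. pd c i (F t) p \<bullet> \<nu> t p = 0)"


section \<open>Geometry of a hypersurface in local coordinates\<close>

text \<open>
  In this section \<open>c\<close> is a chart and \<open>f\<close>, \<open>\<nu>\<close> are an immersion and its unit normal at a fixed time.
\<close>

definition metric :: "('m, 'n::finite) chart \<Rightarrow> ('m \<Rightarrow> real ^ 'N) \<Rightarrow> 'm \<Rightarrow> real ^ 'n ^ 'n" where
  "metric c f p = (\<chi> i j. pd c i f p \<bullet> pd c j f p)"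

definition metric_inv :: "('m, 'n::finite) chart \<Rightarrow> ('m \<Rightarrow> real ^ 'N) \<Rightarrow> 'm \<Rightarrow> real ^ 'n ^ 'n" where
  "metric_inv c f p = matrix_inv (metric c f p)"

text \<open>\<open>christoffel c f k i j\<close> is the Levi-Civita symbol \<open>\<Gamma>\<close> with upper index \<open>k\<close>, lower indices \<open>i, j\<close>.\<close>

definition christoffel ::
    "('m, 'n::finite) chart \<Rightarrow> ('m \<Rightarrow> real ^ 'N) \<Rightarrow> 'n \<Rightarrow> 'n \<Rightarrow> 'n \<Rightarrow> 'm \<Rightarrow> real" where
  "christoffel c f k i j p =
     1/2 * (\<Sum>l\<in>UNIV. metric_inv c f p $ k $ l *
        (pd c i (\<lambda>q. metric c f q $ j $ l) p + pd c j (\<lambda>q. metric c f q $ i $ l) p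
         - pd c l (\<lambda>q. metric c f q $ i $ j) p))"

text \<open>\<open>cov_deriv c f \<omega> i j\<close> is \<open>\<nabla>\<^sub>i \<omega>\<^sub>j\<close> for a 1-form with components \<open>\<omega>\<close> in the chart \<open>c\<close>.\<close>

definition cov_deriv ::
    "('m, 'n::finite) chart \<Rightarrow> ('m \<Rightarrow> real ^ 'N) \<Rightarrow> ('m \<Rightarrow> real ^ 'n) \<Rightarrow> 'n \<Rightarrow> 'n \<Rightarrow> 'm \<Rightarrow> real" where
  "cov_deriv c f \<omega> i j p =
     pd c i (\<lambda>q. \<omega> q $ j) p - (\<Sum>k\<in>UNIV. christoffel c f k i j p * \<omega> p $ k)"

text \<open>The divergence \<open>\<nabla>\<^sup>i \<omega>\<^sub>i\<close>, denoted \<open>d\<^sup>\<dagger> \<omega>\<close> in the flow equation.\<close>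

definition d_dagger ::
    "('m, 'n::finite) chart \<Rightarrow> ('m \<Rightarrow> real ^ 'N) \<Rightarrow> ('m \<Rightarrow> real ^ 'n) \<Rightarrow> 'm \<Rightarrow> real" where
  "d_dagger c f \<omega> p = (\<Sum>i\<in>UNIV. \<Sum>j\<in>UNIV. metric_inv c f p $ i $ j * cov_deriv c f \<omega> i j p)"

definition raise ::
    "('m, 'n::finite) chart \<Rightarrow> ('m \<Rightarrow> real ^ 'N) \<Rightarrow> 'm \<Rightarrow> real ^ 'n \<Rightarrow> real ^ 'n" where
  "raise c f p \<omega> = metric_inv c f p *v \<omega>"

definition second_ff ::
    "('m, 'n::finite) chart \<Rightarrow> ('m \<Rightarrow> real ^ 'N) \<Rightarrow> ('m \<Rightarrow> real ^ 'N) \<Rightarrow> 'm \<Rightarrow> real ^ 'n ^ 'n" where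
  "second_ff c f \<nu> p = (\<chi> i j. - (pd c i f p \<bullet> pd c j \<nu> p))"

definition mean_curvature ::
    "('m, 'n::finite) chart \<Rightarrow> ('m \<Rightarrow> real ^ 'N) \<Rightarrow> ('m \<Rightarrow> real ^ 'N) \<Rightarrow> 'm \<Rightarrow> real" where
  "mean_curvature c f \<nu> p =
     (\<Sum>i\<in>UNIV. \<Sum>j\<in>UNIV. metric_inv c f p $ i $ j * second_ff c f \<nu> p $ i $ j)"

text \<open>
  In a chart of the orientation the volume form is \<open>sqrt (det g) dx\<^sup>1 \<and> \<dots> \<and> dx\<^sup>n\<close>; it is
  evaluated here on \<open>n\<close> tangent vectors at \<open>p\<close>.
\<close>

definition volume_form ::
    "('m, 'n::finite) chart \<Rightarrow> ('m \<Rightarrow> real ^ 'N) \<Rightarrow> 'm \<Rightarrow> ('n \<Rightarrow> ('m, 'n) tangent) \<Rightarrow> real" where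
  "volume_form c f p w = sqrt (det (metric c f p)) * det (\<chi> i j. w j c $ i)"


section \<open>The hyperbolic mean curvature flow\<close>

definition velocity :: "ereal \<Rightarrow> (real \<Rightarrow> 'm \<Rightarrow> real ^ 'N) \<Rightarrow> real \<Rightarrow> 'm \<Rightarrow> real ^ 'N" where
  "velocity T F t p = dt T (\<lambda>s. F s p) t"

definition normal_speed ::
    "ereal \<Rightarrow> (real \<Rightarrow> 'm \<Rightarrow> real ^ 'N) \<Rightarrow> (real \<Rightarrow> 'm \<Rightarrow> real ^ 'N) \<Rightarrow> real \<Rightarrow> 'm \<Rightarrow> real" where
  "normal_speed T F \<nu> t p = velocity T F t p \<bullet> \<nu> t p"

definition tangential_velocity ::
    "('m, 'n::finite) chart \<Rightarrow> ereal \<Rightarrow> (real \<Rightarrow> 'm \<Rightarrow> real ^ 'N) \<Rightarrow> real \<Rightarrow> 'm \<Rightarrow> real ^ 'n" where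
  "tangential_velocity c T F t p = (\<chi> i. velocity T F t p \<bullet> pd c i (F t) p)"

definition S_eval ::
    "('m, 'n::finite) chart \<Rightarrow> ereal \<Rightarrow> (real \<Rightarrow> 'm \<Rightarrow> real ^ 'N) \<Rightarrow>
     real \<Rightarrow> 'm \<Rightarrow> ('m, 'n) tangent \<Rightarrow> real" where
  "S_eval c T F t p v = (\<Sum>i\<in>UNIV. tangential_velocity c T F t p $ i * v c $ i)"

text \<open>The dimension \<open>n\<close> is supplied as a number.\<close>

definition energy_density ::
    "nat \<Rightarrow> ereal \<Rightarrow> (real \<Rightarrow> 'm \<Rightarrow> real ^ 'N) \<Rightarrow> real \<Rightarrow> 'm \<Rightarrow> real" where
  "energy_density n T F t p = 1/2 * ((norm (velocity T F t p))\<^sup>2 + real n)"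

definition HMCF ::
    "'m topology \<Rightarrow> ('m, 'n::finite) chart set \<Rightarrow> ereal \<Rightarrow>
     (real \<Rightarrow> 'm \<Rightarrow> real ^ 'N) \<Rightarrow> (real \<Rightarrow> 'm \<Rightarrow> real ^ 'N) \<Rightarrow> bool" where
  "HMCF M A T F \<nu> \<longleftrightarrow>
     (\<forall>t\<in>time_span T. \<forall>c\<in>smooth_charts M A. \<forall>p\<in>domain c.
        let S = tangential_velocity c T F t;
            S_sharp = raise c (F t) p (S p);
            S_sq = S p \<bullet> S_sharp;
            e = energy_density CARD('n) T F t;
            grad_e = raise c (F t) p (\<chi> i. pd c i e p);
            H = mean_curvature c (F t) (\<nu> t) p;
            \<sigma> = normal_speed T F \<nu> t p;
            div_S = d_dagger c (F t) S p
        in dt T (\<lambda>s. velocity T F s p) t =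
             ((e p - S_sq) * H - \<sigma> * div_S) *\<^sub>R \<nu> t p
             + (\<Sum>k\<in>UNIV. ((\<sigma> * H - div_S) * S_sharp $ k - grad_e $ k) *\<^sub>R pd c k (F t) p))"

end

(*
  In a chart put V = dF/dt. The equation gives <F_tt, F_i> = (sigma H - div S) S_i - d_i e, and
  <V, d_i V> = d_i e, so exchanging d_t with d_i yields d/dt S_i = (sigma H - div S) S_i. The first
  variation of the volume is d/dt sqrt (det g) = sqrt (det g) g^{ij} <d_i V, F_j>, and splitting V
  into its tangential and normal parts turns the last factor into div S - sigma H. The two rates
  cancel in the product.
*)

theory Submission
  imports Defs
begin

text \<open>Two features shape the work: \<open>F\<close> is only of class C^2, and time is
  one-sided at 0, so the exchange of derivatives must also hold at the edge of the domain. One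
  derivative of \<open>F\<close> is spent on the velocity, the frame F_i and the metric; these and
  \<nu> are C^1, just enough for the Christoffel symbols, div S and H to be genuine derivatives.

  The splitting of V is not done by differentiating its two parts. The product rule for <V, F_j>
  leaves the term <V, F_ij>, which is expanded in the basis F_1, ..., F_n, \<nu> of the ambient
  space: its tangential part is the Christoffel correction in the covariant derivative, and its
  normal part is \<sigma> h_ij. The convention h_ij = - <F_i, d_j \<nu>> fixes the sign of this last
  term, and hence the cancellation of the two rates.\<close>

lemma at_within_Icc_neq_bot:
  fixes t :: real
  assumes "a < b" "t \<in> {a..b}"
  shows "at t within {a..b} \<noteq> bot"
  using assms by (simp add: trivial_limit_within islimpt_Icc)


section \<open>Mixed partial derivatives\<close>

text \<open>One-sided at the endpoints, hence applicable at the initial time: by the fundamental theorem of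
  calculus \<open>g s = g a + \<integral> gs\<close> on \<open>[a, s]\<close>, which is differentiated in \<open>y\<close> under the integral sign.\<close>

lemma mixed_vector_derivative:
  fixes g :: "real \<Rightarrow> real \<Rightarrow> 'b::banach"
  assumes gs: "\<And>s y. s \<in> {a..b} \<Longrightarrow> y \<in> {c..d} \<Longrightarrow>
      ((\<lambda>s. g s y) has_vector_derivative gs s y) (at s within {a..b})"
    and gy: "\<And>s. s \<in> {a..b} \<Longrightarrow> (g s has_vector_derivative gy s) (at y0 within {c..d})"
    and gsy: "\<And>s y. s \<in> {a..b} \<Longrightarrow> y \<in> {c..d} \<Longrightarrow>
      (gs s has_vector_derivative gsy s y) (at y within {c..d})"
    and cont: "continuous_on ({a..b} \<times> {c..d}) (\<lambda>(s, y). gsy s y)"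
    and s0: "s0 \<in> {a..b}" and y0: "y0 \<in> {c..d}" and "c < d"
  shows "(gy has_vector_derivative gsy s0 y0) (at s0 within {a..b})"
proof -
  have cont': "continuous_on ({c..d} \<times> {a..s}) (\<lambda>(y, r). gsy r y)" if "s \<le> b" for s
  proof -
    have "continuous_on ({c..d} \<times> {a..s}) ((\<lambda>(s, y). gsy s y) \<circ> prod.swap)"
      by (intro continuous_on_compose continuous_on_swap continuous_on_subset[OF cont])
        (use that in auto)
    then show ?thesis
      by (simp add: case_prod_unfold comp_def)
  qed
  have ftc: "((\<lambda>r. gs r y) has_integral (g s y - g a y)) {a..s}" if "s \<in> {a..b}" "y \<in> {c..d}" for s y
    by (rule fundamental_theorem_of_calculus)
      (use that in \<open>auto intro: has_vector_derivative_within_subset[OF gs]\<close>)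
  \<comment> \<open>The integral form supplies one derivative of \<open>g s\<close> at
    \<open>y0\<close>, the hypothesis supplies \<open>gy s\<close> as another. They agree because
    \<open>c < d\<close> makes derivatives within the interval unique.\<close>
  have gy_eq: "gy s = gy a + integral {a..s} (\<lambda>r. gsy r y0)" if s: "s \<in> {a..b}" for s
  proof -
    have leibniz: "((\<lambda>y. integral (cbox a s) (\<lambda>r. gs r y)) has_vector_derivative
        integral (cbox a s) (\<lambda>r. gsy r y0)) (at y0 within {c..d})"
      by (rule leibniz_rule_vector_derivative)
        (use s y0 cont' ftc gsy in \<open>auto intro: has_integral_integrable\<close>)
    have D: "((\<lambda>y. g a y + integral {a..s} (\<lambda>r. gs r y)) has_vector_derivative
        gy a + integral {a..s} (\<lambda>r. gsy r y0)) (at y0 within {c..d})"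
      using leibniz by (intro has_vector_derivative_add gy) (use s in auto)
    have "g s y = g a y + integral {a..s} (\<lambda>r. gs r y)" if "y \<in> {c..d}" for y
      using ftc[OF s that] by (simp add: integral_unique)
    then have "(g s has_vector_derivative gy a + integral {a..s} (\<lambda>r. gsy r y0))
        (at y0 within {c..d})"
      by (rule has_vector_derivative_transform[OF y0 _ D])
    then show ?thesis
      using gy[OF s] vector_derivative_unique_within at_within_Icc_neq_bot[OF \<open>c < d\<close> y0] by blast
  qed
  have "continuous_on {a..b} (\<lambda>r. gsy r y0)"
    using continuous_on_compose2[OF cont, of "{a..b}" "\<lambda>r. (r, y0)"] y0
    by (simp add: continuous_on_Pair image_subset_iff)
  then have D: "((\<lambda>s. gy a + integral {a..s} (\<lambda>r. gsy r y0)) has_vector_derivative gsy s0 y0)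
      (at s0 within {a..b})"
    by (auto intro!: derivative_eq_intros integral_has_vector_derivative s0)
  show ?thesis
    by (rule has_vector_derivative_transform[OF s0 _ D]) (rule gy_eq)
qed


section \<open>Partial derivatives on a product\<close>

lemma Ck_on_cong:
  assumes "\<And>x. x \<in> S \<Longrightarrow> f x = g x"
  shows "Ck_on k f S \<longleftrightarrow> Ck_on k g S"
proof (cases k)
  case 0
  then show ?thesis
    using assms by (simp cong: continuous_on_cong)
next
  case (Suc k)
  have "(f has_derivative f') (at x within S) \<longleftrightarrow> (g has_derivative f') (at x within S)"
    if "x \<in> S" for x f'
    using assms that has_derivative_transform by metis
  with Suc show ?thesis
    by (simp cong: ball_cong)
qed

lemma Ck_on_imp_continuous_on: "Ck_on k f S \<Longrightarrow> continuous_on S f"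
  by (cases k) (auto simp: continuous_on_eq_continuous_within intro: has_derivative_continuous)

text \<open>The exchange of derivatives needs a compact time interval, while
  \<open>time_span T\<close> is half-open and possibly unbounded. Choosing \<open>b\<close> strictly
  beyond \<open>t\<close> and keeping 0 as the left end leaves the filter at \<open>t\<close>
  unchanged, also for \<open>t = 0\<close>.\<close>

lemma time_span_locally_Icc:
  assumes "t \<in> time_span T"
  obtains b where "t < b" "{0..b} \<subseteq> time_span T" "at t within time_span T = at t within {0..b}"
    "0 \<le> t"
proof -
  have "ereal t < T" "0 \<le> t"
    using assms by (auto simp: time_span_def)
  then obtain b where b: "t < b" "ereal b < T"
    by (metis ereal_dense2 less_ereal.simps(1))
  have sub: "{0..b} \<subseteq> time_span T"
    using b by (auto simp: time_span_def intro: le_less_trans[of _ "ereal b"])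
  have "at t within time_span T = at t within {0..b}"
    by (rule at_within_nhd[of _ "{..<b}"]) (use b sub in \<open>auto simp: time_span_def\<close>)
  with b sub \<open>0 \<le> t\<close> that show thesis by blast
qed

text \<open>\<open>dt\<close> is a choice operator, so its value is known only where derivatives are
  unique. Here they are, because the time span contains a nondegenerate interval around or to the
  right of each of its points.\<close>

lemma dt_eqI:
  assumes "t \<in> time_span T" "(f has_vector_derivative f') (at t within time_span T)"
  shows "dt T f t = f'"
proof -
  obtain b where b: "t < b" "at t within time_span T = at t within {0..b}" "0 \<le> t"
    using time_span_locally_Icc[OF assms(1)] by metis
  then have "0 < b" "t \<in> {0..b}" by auto
  then show ?thesis
    unfolding dt_def
    by (intro vector_derivative_within assms(2)) (simp add: b(2) at_within_Icc_neq_bot)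
qed

lemma has_vector_derivative_fst_slice:
  assumes "((\<lambda>(t, x). h t x) has_derivative h') (at (t, x) within I \<times> U)" "x \<in> U"
  shows "((\<lambda>s. h s x) has_vector_derivative h' (1, 0)) (at t within I)"
proof -
  have "((\<lambda>(t, x). h t x) \<circ> (\<lambda>s. (s, x)) has_derivative h' \<circ> (\<lambda>r. (r, 0))) (at t within I)"
    by (rule diff_chain_within)
      (use assms(2) in \<open>auto intro!: derivative_eq_intros has_derivative_subset[OF assms(1)]\<close>)
  moreover have "h' \<circ> (\<lambda>r. (r, 0)) = (\<lambda>r. r *\<^sub>R h' (1, 0))"
  proof
    show "(h' \<circ> (\<lambda>r. (r, 0))) r = r *\<^sub>R h' (1, 0)" for r
      using linear_scale[OF has_derivative_linear[OF assms(1)], of r "(1, 0)"] by simp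
  qed
  ultimately show ?thesis
    by (simp add: has_vector_derivative_def comp_def)
qed

lemma has_derivative_snd_slice:
  assumes "((\<lambda>(t, x). h t x) has_derivative h') (at (t, x) within I \<times> U)" "t \<in> I"
  shows "(h t has_derivative (\<lambda>v. h' (0, v))) (at x within U)"
proof -
  have "((\<lambda>(t, x). h t x) \<circ> (\<lambda>x. (t, x)) has_derivative h' \<circ> (\<lambda>v. (0, v))) (at x within U)"
    by (rule diff_chain_within)
      (use assms(2) in \<open>auto intro!: derivative_eq_intros has_derivative_subset[OF assms(1)]\<close>)
  then show ?thesis
    by (simp add: comp_def)
qed


section \<open>Derivatives in a chart\<close>

text \<open>The condition of \<open>Ck_family\<close> in a single chart; all computations take place
  in one fixed chart.\<close>

abbreviation Ck_chart ::
    "nat \<Rightarrow> ('m, 'n::finite) chart \<Rightarrow> ereal \<Rightarrow> (real \<Rightarrow> 'm \<Rightarrow> 'b::real_normed_vector) \<Rightarrow> bool" where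
  "Ck_chart k c T f \<equiv>
     Ck_on k (\<lambda>(t, x). f t (parametrization c x)) (time_span T \<times> coords c ` domain c)"

lemma is_chart_inj_on:
  assumes "is_chart M c"
  shows "inj_on (coords c) (domain c)"
  using assms unfolding is_chart_def
  by (metis homeomorphic_imp_injective_map inf.absorb_iff2 openin_subset topspace_subtopology)

lemma parametrization_coords [simp]:
  assumes "is_chart M c" "p \<in> domain c"
  shows "parametrization c (coords c p) = p"
  using is_chart_inj_on[OF assms(1)] assms(2) by simp

lemma is_chart_open: "is_chart M c \<Longrightarrow> open (coords c ` domain c)"
  by (simp add: is_chart_def)

text \<open>All four facts are read off one total derivative \<open>h'\<close>: its value on
  \<open>(1, 0)\<close> is the time derivative, its value on \<open>(0, axis i 1)\<close> the
  coordinate derivative, and \<open>Ck_on\<close> makes these components of class \<open>k\<close>.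
  Time stays one-sided, whereas the open coordinate image turns the spatial derivative into a full
  one.\<close>

lemma
  fixes f :: "real \<Rightarrow> 'm \<Rightarrow> 'b::real_normed_vector" and c :: "('m, 'n::finite) chart"
  assumes f: "Ck_chart (Suc k) c T f" and c: "is_chart M c"
  shows Ck_chart_dt: "Ck_chart k c T (\<lambda>t p. dt T (\<lambda>s. f s p) t)"
    and Ck_chart_pd: "Ck_chart k c T (\<lambda>t. pd c i (f t))"
    and has_vector_derivative_dt: "t \<in> time_span T \<Longrightarrow> p \<in> domain c \<Longrightarrow>
      ((\<lambda>s. f s p) has_vector_derivative dt T (\<lambda>s. f s p) t) (at t within time_span T)"
    and Ck_chart_differentiable: "t \<in> time_span T \<Longrightarrow> p \<in> domain c \<Longrightarrow>
      (f t \<circ> parametrization c) differentiable (at (coords c p))"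
proof -
  obtain h' where D: "\<And>z. z \<in> time_span T \<times> coords c ` domain c \<Longrightarrow>
      ((\<lambda>(t, x). f t (parametrization c x)) has_derivative h' z)
        (at z within time_span T \<times> coords c ` domain c)"
    and C: "\<And>b. b \<in> Basis \<Longrightarrow> Ck_on k (\<lambda>z. h' z b) (time_span T \<times> coords c ` domain c)"
    using f by auto
  have 1: "((\<lambda>s. f s (parametrization c x)) has_vector_derivative h' (t, x) (1, 0))
      (at t within time_span T)" if "t \<in> time_span T" "x \<in> coords c ` domain c" for t x
    by (rule has_vector_derivative_fst_slice[OF D]) (use that in auto)
  have 2: "((\<lambda>x. f t (parametrization c x)) has_derivative (\<lambda>v. h' (t, x) (0, v))) (at x)"
    if "t \<in> time_span T" "x \<in> coords c ` domain c" for t x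
    using has_derivative_snd_slice[OF D[of "(t, x)"]] that
    unfolding at_within_open[OF that(2) is_chart_open[OF c]] by simp
  have 3: "Ck_on k (\<lambda>z. h' z (1, 0)) (time_span T \<times> coords c ` domain c)"
    by (rule C) (simp add: Basis_prod_def)
  have 4: "Ck_on k (\<lambda>z. h' z (0, b)) (time_span T \<times> coords c ` domain c)" if "b \<in> Basis" for b
    by (rule C) (use that in \<open>simp add: Basis_prod_def\<close>)
  have dt: "dt T (\<lambda>s. f s (parametrization c x)) t = h' (t, x) (1, 0)"
    if "t \<in> time_span T" "x \<in> coords c ` domain c" for t x
    using dt_eqI 1 that by blast
  show "Ck_chart k c T (\<lambda>t p. dt T (\<lambda>s. f s p) t)"
    using 3 by (subst Ck_on_cong[where g = "\<lambda>z. h' z (1, 0)"]) (use dt in auto)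
  have "pd c i (f t) (parametrization c x) = h' (t, x) (0, axis i 1)"
    if "t \<in> time_span T" "x \<in> coords c ` domain c" for t x
    using frechet_derivative_at[OF 2[OF that]] that
    by (simp add: pd_def comp_def f_inv_into_f fun_eq_iff)
  then show "Ck_chart k c T (\<lambda>t. pd c i (f t))"
    using 4[of "axis i 1"]
    by (subst Ck_on_cong[where g = "\<lambda>z. h' z (0, axis i 1)"]) (auto simp: axis_in_Basis_iff)
  show "((\<lambda>s. f s p) has_vector_derivative dt T (\<lambda>s. f s p) t) (at t within time_span T)"
    if "t \<in> time_span T" "p \<in> domain c"
    using 1[of t "coords c p"] dt[of t "coords c p"] that c by simp
  show "(f t \<circ> parametrization c) differentiable (at (coords c p))"
    if "t \<in> time_span T" "p \<in> domain c"
    using 2[of t "coords c p"] that by (auto simp: differentiable_def comp_def)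
qed

text \<open>Restriction to a coordinate line turns \<open>pd\<close> into a derivative in one real
  variable, the form in which \<open>mixed_vector_derivative\<close> takes its data.\<close>

lemma pd_line:
  assumes "(f \<circ> parametrization c) differentiable (at (x + y *\<^sub>R axis i 1))"
    and "x + y *\<^sub>R axis i 1 \<in> coords c ` domain c"
  shows "((\<lambda>r. f (parametrization c (x + r *\<^sub>R axis i 1))) has_vector_derivative
    pd c i f (parametrization c (x + y *\<^sub>R axis i 1))) (at y within S)"
proof -
  let ?L = "frechet_derivative (f \<circ> parametrization c) (at (x + y *\<^sub>R axis i 1))"
  have D: "(f \<circ> parametrization c has_derivative ?L) (at (x + y *\<^sub>R axis i 1))"
    using assms(1) by (simp add: frechet_derivative_works)
  have "((f \<circ> parametrization c) \<circ> (\<lambda>r. x + r *\<^sub>R axis i 1) has_derivative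
      ?L \<circ> (\<lambda>r. r *\<^sub>R axis i 1)) (at y within S)"
    by (rule diff_chain_within) (auto intro!: derivative_eq_intros has_derivative_at_withinI[OF D])
  moreover have "?L \<circ> (\<lambda>r. r *\<^sub>R axis i 1) = (\<lambda>r. r *\<^sub>R ?L (axis i 1))"
    using linear_scale[OF has_derivative_linear[OF D]] by (simp add: fun_eq_iff)
  ultimately show ?thesis
    using assms(2) by (simp add: pd_def comp_def has_vector_derivative_def f_inv_into_f)
qed

lemma Ck_chart_pd_line:
  assumes "Ck_chart (Suc k) c T f" "is_chart M c" "t \<in> time_span T"
    and "x + y *\<^sub>R axis i 1 \<in> coords c ` domain c"
  shows "((\<lambda>r. f t (parametrization c (x + r *\<^sub>R axis i 1))) has_vector_derivative
    pd c i (f t) (parametrization c (x + y *\<^sub>R axis i 1))) (at y within S)"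
proof (rule pd_line[OF _ assms(4)])
  have "parametrization c (x + y *\<^sub>R axis i 1) \<in> domain c"
    by (rule inv_into_into[OF assms(4)])
  from Ck_chart_differentiable[OF assms(1-3) this]
  show "(f t \<circ> parametrization c) differentiable (at (x + y *\<^sub>R axis i 1))"
    by (simp add: f_inv_into_f[OF assms(4)])
qed

text \<open>Along the coordinate line through \<open>p\<close> the family becomes a function on a
  rectangle \<open>{0..b} \<times> {-d..d}\<close>, to which \<open>mixed_vector_derivative\<close>
  applies. The existence of the time derivative of d_i f is part of what it yields.\<close>

lemma has_vector_derivative_pd_commute:
  fixes f :: "real \<Rightarrow> 'm \<Rightarrow> 'b::banach" and c :: "('m, 'n::finite) chart"
  assumes f: "Ck_chart (Suc (Suc k)) c T f" and c: "is_chart M c"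
    and t: "t \<in> time_span T" and p: "p \<in> domain c"
  shows "((\<lambda>s. pd c i (f s) p) has_vector_derivative pd c i (\<lambda>q. dt T (\<lambda>s. f s q) t) p)
    (at t within time_span T)"
proof -
  obtain b where b: "t < b" "{0..b} \<subseteq> time_span T"
    "at t within time_span T = at t within {0..b}" "0 \<le> t"
    using time_span_locally_Icc[OF t] .
  define x where "x = coords c p"
  obtain d where d: "d > 0" "cball x d \<subseteq> coords c ` domain c"
    using is_chart_open[OF c] p unfolding x_def by (metis imageI open_contains_cball)
  have U: "x + y *\<^sub>R axis i 1 \<in> coords c ` domain c" if "y \<in> {-d..d}" for y
    using d(2) that by (auto simp: dist_norm norm_axis_1 intro!: subsetD[OF d(2)])
  define q where "q y = parametrization c (x + y *\<^sub>R axis i 1)" for y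
  have q: "q y \<in> domain c" if "y \<in> {-d..d}" for y
    unfolding q_def by (rule inv_into_into[OF U[OF that]])
  have q0: "q 0 = p"
    using c p by (simp add: q_def x_def)
  note dt_f = Ck_chart_dt[OF f c]
  have "Ck_chart k c T (\<lambda>t. pd c i (\<lambda>p. dt T (\<lambda>s. f s p) t))"
    by (rule Ck_chart_pd[OF dt_f c])
  then have cont: "continuous_on (time_span T \<times> coords c ` domain c)
      (\<lambda>(t, x). pd c i (\<lambda>p. dt T (\<lambda>s. f s p) t) (parametrization c x))"
    by (rule Ck_on_imp_continuous_on)
  have "((\<lambda>s. pd c i (f s) (q 0)) has_vector_derivative
      pd c i (\<lambda>p. dt T (\<lambda>s. f s p) t) (q 0)) (at t within {0..b})"
  proof (rule mixed_vector_derivative[where g = "\<lambda>s y. f s (q y)" and c = "-d" and d = d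
        and gs = "\<lambda>s y. dt T (\<lambda>s. f s (q y)) s"
        and gsy = "\<lambda>s y. pd c i (\<lambda>p. dt T (\<lambda>s. f s p) s) (q y)"])
    show "((\<lambda>s. f s (q y)) has_vector_derivative dt T (\<lambda>s. f s (q y)) s) (at s within {0..b})"
      if "s \<in> {0..b}" "y \<in> {-d..d}" for s y
      using has_vector_derivative_within_subset[OF _ b(2)]
        has_vector_derivative_dt[OF f c _ q[OF that(2)]] that(1) b(2) by blast
    show "((\<lambda>y. f s (q y)) has_vector_derivative pd c i (f s) (q 0)) (at 0 within {-d..d})"
      if "s \<in> {0..b}" for s
      unfolding q_def by (rule Ck_chart_pd_line[OF f c]) (use that b(2) U[of 0] d(1) in auto)
    show "((\<lambda>y. dt T (\<lambda>s. f s (q y)) s) has_vector_derivative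
        pd c i (\<lambda>p. dt T (\<lambda>s. f s p) s) (q y)) (at y within {-d..d})"
      if "s \<in> {0..b}" "y \<in> {-d..d}" for s y
      unfolding q_def by (rule Ck_chart_pd_line[OF dt_f c]) (use that b(2) U in auto)
    show "continuous_on ({0..b} \<times> {-d..d})
        (\<lambda>(s, y). pd c i (\<lambda>p. dt T (\<lambda>s. f s p) s) (q y))"
    proof -
      have "continuous_on ({0..b} \<times> {-d..d}) (\<lambda>z. case (fst z, x + snd z *\<^sub>R axis i 1) of
          (t, x) \<Rightarrow> pd c i (\<lambda>p. dt T (\<lambda>s. f s p) t) (parametrization c x))"
        by (rule continuous_on_compose2[OF cont]) (use U b(2) in \<open>auto intro!: continuous_intros\<close>)
      then show ?thesis
        by (simp add: case_prod_unfold q_def)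
    qed
  qed (use b d in auto)
  then show ?thesis
    by (simp add: q0 b(3))
qed

text \<open>At frozen time the mixed-derivative lemma is applied to two coordinate directions. It
  gives one derivative of d_j f along x^i; the differentiability of d_j f gives the other, and
  uniqueness identifies them.\<close>

lemma pd_commute:
  fixes f :: "real \<Rightarrow> 'm \<Rightarrow> 'b::banach" and c :: "('m, 'n::finite) chart"
  assumes f: "Ck_chart (Suc (Suc k)) c T f" and c: "is_chart M c"
    and t: "t \<in> time_span T" and p: "p \<in> domain c"
  shows "pd c i (pd c j (f t)) p = pd c j (pd c i (f t)) p"
proof -
  define x where "x = coords c p"
  obtain d where d: "d > 0" "cball x d \<subseteq> coords c ` domain c"
    using is_chart_open[OF c] p unfolding x_def by (metis imageI open_contains_cball)
  \<comment> \<open>Two displacements share the radius \<open>d\<close>, so each gets half of it.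
    The triangle inequality suffices and covers \<open>i = j\<close> as well.\<close>
  define I where "I = {-(d/2)..d/2}"
  have U: "x + s *\<^sub>R axis i 1 + y *\<^sub>R axis j 1 \<in> coords c ` domain c" if "s \<in> I" "y \<in> I" for s y
  proof -
    have "norm (s *\<^sub>R axis i 1 + y *\<^sub>R axis j 1 :: real^'n) \<le> \<bar>s\<bar> + \<bar>y\<bar>"
      by (rule norm_triangle_le) (simp add: norm_axis_1)
    also have "\<dots> \<le> d"
      using that by (auto simp: I_def)
    finally show ?thesis
      using d(2) by (simp add: subset_iff dist_norm add.assoc norm_minus_commute)
  qed
  define q where "q s y = parametrization c (x + s *\<^sub>R axis i 1 + y *\<^sub>R axis j 1)" for s y
  have q0: "q 0 0 = p"
    using c p by (simp add: q_def x_def)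
  have I0: "0 \<in> I"
    using d by (simp add: I_def)
  note pd_f = Ck_chart_pd[OF f c]
  have "Ck_chart k c T (\<lambda>t. pd c j (pd c i (f t)))"
    by (rule Ck_chart_pd[OF pd_f c])
  then have cont: "continuous_on (time_span T \<times> coords c ` domain c)
      (\<lambda>(t, x). pd c j (pd c i (f t)) (parametrization c x))"
    by (rule Ck_on_imp_continuous_on)
  have "((\<lambda>s. pd c j (f t) (q s 0)) has_vector_derivative pd c j (pd c i (f t)) (q 0 0))
      (at 0 within I)"
    unfolding I_def
  proof (rule mixed_vector_derivative[where g = "\<lambda>s y. f t (q s y)" and c = "-(d/2)" and d = "d/2"
        and gs = "\<lambda>s y. pd c i (f t) (q s y)"
        and gsy = "\<lambda>s y. pd c j (pd c i (f t)) (q s y)"], fold I_def)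
    show "((\<lambda>s. f t (q s y)) has_vector_derivative pd c i (f t) (q s y)) (at s within I)"
      if "s \<in> I" "y \<in> I" for s y
      using Ck_chart_pd_line[OF f c t, of "x + y *\<^sub>R axis j 1" s i] U[OF that]
      by (simp add: q_def ac_simps)
    show "((\<lambda>y. f t (q s y)) has_vector_derivative pd c j (f t) (q s 0)) (at 0 within I)"
      if "s \<in> I" for s
      unfolding q_def by (rule Ck_chart_pd_line[OF f c t]) (rule U[OF that I0])
    show "((\<lambda>y. pd c i (f t) (q s y)) has_vector_derivative pd c j (pd c i (f t)) (q s y))
        (at y within I)" if "s \<in> I" "y \<in> I" for s y
      unfolding q_def by (rule Ck_chart_pd_line[OF pd_f c t]) (rule U[OF that])
    show "continuous_on (I \<times> I) (\<lambda>(s, y). pd c j (pd c i (f t)) (q s y))"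
    proof -
      have "continuous_on (I \<times> I) (\<lambda>z. case (t, x + fst z *\<^sub>R axis i 1 + snd z *\<^sub>R axis j 1) of
          (t, x) \<Rightarrow> pd c j (pd c i (f t)) (parametrization c x))"
        by (rule continuous_on_compose2[OF cont]) (use U t in \<open>auto intro!: continuous_intros\<close>)
      then show ?thesis
        by (simp add: case_prod_unfold q_def)
    qed
  qed (use d I0 in auto)
  moreover have "((\<lambda>s. pd c j (f t) (q s 0)) has_vector_derivative pd c i (pd c j (f t)) (q 0 0))
      (at 0 within I)"
    using Ck_chart_pd_line[OF pd_f c t, of x 0 i] U[OF I0 I0] by (simp add: q_def)
  moreover have "at 0 within I \<noteq> bot"
    using d unfolding I_def by (intro at_within_Icc_neq_bot) auto
  ultimately show ?thesis
    unfolding q0 by (metis vector_derivative_unique_within)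
qed


section \<open>Determinants and Gram matrices\<close>

text \<open>A permutation that fixes every point but one fixes that point too. So a non-identity
  \<open>p\<close> moves some \<open>j\<close> other than \<open>i\<close>, and the factor of this
  \<open>j\<close> vanishes.\<close>

lemma prod_indicator_remove1:
  assumes p: "p permutes (UNIV :: 'n::finite set)" and "p \<noteq> id"
  shows "(\<Prod>j\<in>UNIV - {i}. if j = p j then 1 else 0 :: real) = 0"
proof -
  have "\<exists>j. j \<noteq> i \<and> j \<noteq> p j"
  proof (rule ccontr)
    assume "\<not> ?thesis"
    then have fix': "p j = j" if "j \<noteq> i" for j
      using that by metis
    then have "p i = i"
      using permutes_inj[OF p] by (metis injD)
    with fix' \<open>p \<noteq> id\<close> show False
      by (metis eq_id_iff)
  qed
  then show ?thesis
    by (intro prod_zero) auto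
qed

text \<open>In the Leibniz expansion a non-identity permutation picks at least two off-diagonal
  entries. Differentiating one of them leaves a zero factor, so only the product of the diagonal
  contributes, and it gives the trace.\<close>

lemma has_real_derivative_det_at_mat_1:
  fixes B :: "real \<Rightarrow> real^'n::finite^'n"
  assumes B: "\<And>i j. ((\<lambda>s. B s $ i $ j) has_real_derivative B' $ i $ j) (at t within S)"
    and B1: "B t = mat 1"
  shows "((\<lambda>s. det (B s)) has_real_derivative trace B') (at t within S)"
proof -
  have prod: "((\<lambda>s. \<Prod>i\<in>UNIV. B s $ i $ p i) has_derivative
      (\<lambda>y. \<Sum>i\<in>UNIV. (y * B' $ i $ p i) * (\<Prod>j\<in>UNIV - {i}. B t $ j $ p j))) (at t within S)" for p
    using B by (intro has_derivative_prod) (simp add: has_field_derivative_def mult_commute_abs)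
  have coeff: "(\<Sum>i\<in>UNIV. B' $ i $ p i * (\<Prod>j\<in>UNIV - {i}. B t $ j $ p j)) =
      (if p = id then trace B' else 0)" if "p permutes UNIV" for p
    using prod_indicator_remove1[OF that]
    by (auto simp: B1 mat_def trace_def simp del: prod_zero_iff)
  have prod': "((\<lambda>s. \<Prod>i\<in>UNIV. B s $ i $ p i) has_real_derivative
      (if p = id then trace B' else 0)) (at t within S)" if "p permutes UNIV" for p
    using prod[of p]
    unfolding has_field_derivative_def mult.assoc sum_distrib_left[symmetric] coeff[OF that]
      mult_commute_abs .
  have "((\<lambda>s. det (B s)) has_real_derivative
      (\<Sum>p\<in>{p. p permutes (UNIV :: 'n set)}.
        of_int (sign p) * (if p = id then trace B' else 0))) (at t within S)"
    unfolding det_def by (intro DERIV_sum DERIV_cmult prod') simp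
  moreover have "(\<Sum>p\<in>{p. p permutes (UNIV :: 'n set)}.
      of_int (sign p) * (if p = id then trace B' else 0)) = trace B'"
    by (subst sum.remove[of _ id])
      (auto simp: finite_permutations sign_id permutes_id intro!: sum.neutral)
  ultimately show ?thesis
    by simp
qed

lemma matrix_inv:
  fixes G :: "real^'n::finite^'n"
  assumes "det G \<noteq> 0"
  shows "G ** matrix_inv G = mat 1" "matrix_inv G ** G = mat 1"
proof -
  have "\<exists>G'. G ** G' = mat 1 \<and> G' ** G = mat 1"
    using assms unfolding invertible_det_nz[symmetric] invertible_def .
  from someI_ex[OF this] show "G ** matrix_inv G = mat 1" "matrix_inv G ** G = mat 1"
    unfolding matrix_inv_def by auto
qed

lemma transpose_matrix_inv_symmetric:
  fixes G :: "real^'n::finite^'n"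
  assumes "det G \<noteq> 0" "transpose G = G"
  shows "transpose (matrix_inv G) = matrix_inv G"
proof -
  have "transpose (matrix_inv G) ** G = mat 1"
    using matrix_inv(1)[OF assms(1)] assms(2) by (metis matrix_transpose_mul transpose_mat)
  then show ?thesis
    using matrix_inv(1)[OF assms(1)] by (metis matrix_mul_assoc matrix_mul_lid matrix_mul_rid)
qed

text \<open>Jacobi's formula reduces to the identity matrix: multiplying \<open>G s\<close> by the
  constant inverse of \<open>G t\<close> gives a curve through \<open>mat 1\<close>, and
  multiplicativity of \<open>det\<close> restores the factor \<open>det (G t)\<close>.\<close>

lemma has_real_derivative_det:
  fixes G :: "real \<Rightarrow> real^'n::finite^'n"
  assumes G: "\<And>i j. ((\<lambda>s. G s $ i $ j) has_real_derivative G' $ i $ j) (at t within S)"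
    and "det (G t) \<noteq> 0"
  shows "((\<lambda>s. det (G s)) has_real_derivative det (G t) * trace (G' ** matrix_inv (G t)))
    (at t within S)"
proof -
  let ?I = "matrix_inv (G t)"
  have "((\<lambda>s. det (G s ** ?I)) has_real_derivative trace (G' ** ?I)) (at t within S)"
  proof (rule has_real_derivative_det_at_mat_1)
    show "((\<lambda>s. (G s ** ?I) $ i $ j) has_real_derivative (G' ** ?I) $ i $ j) (at t within S)" for i j
      unfolding matrix_matrix_mult_def
      by (auto intro!: derivative_eq_intros G sum.cong)
  qed (rule matrix_inv[OF assms(2)])
  then have "((\<lambda>s. det (G t) * det (G s ** ?I)) has_real_derivative det (G t) * trace (G' ** ?I))
      (at t within S)"
    by (rule DERIV_cmult)
  moreover have "det (G t) * det (G s ** ?I) = det (G s)" for s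
    using arg_cong[OF matrix_inv(2)[OF assms(2)], of det] by (simp add: det_mul mult.commute)
  ultimately show ?thesis
    by simp
qed

text \<open>The real square root is extended as an odd function, so \<open>sqrt d / (2 * d)\<close>
  is its derivative at every nonzero \<open>d\<close>. Nonvanishing of the determinant is exactly
  what linear independence of the frame provides.\<close>

lemma has_real_derivative_sqrt_det:
  fixes G :: "real \<Rightarrow> real^'n::finite^'n"
  assumes G: "\<And>i j. ((\<lambda>s. G s $ i $ j) has_real_derivative G' $ i $ j) (at t within S)"
    and "det (G t) \<noteq> 0"
  shows "((\<lambda>s. sqrt (det (G s))) has_real_derivative
    sqrt (det (G t)) * (trace (G' ** matrix_inv (G t)) / 2)) (at t within S)"
proof -
  let ?d = "det (G t)"
  have "(sqrt has_real_derivative sqrt ?d / (2 * ?d)) (at ?d)"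
  proof (rule DERIV_real_sqrt_generic[OF assms(2)])
    show "sqrt ?d / (2 * ?d) = inverse (sqrt ?d) / 2" if "?d > 0"
      using sqrt_divide_self_eq[of ?d] that by simp
    show "sqrt ?d / (2 * ?d) = - inverse (sqrt ?d) / 2" if "?d < 0"
      using sqrt_divide_self_eq[of "- ?d"] that by (simp add: real_sqrt_minus)
  qed
  from DERIV_chain2[OF this has_real_derivative_det[OF G assms(2)]] assms(2) show ?thesis
    by simp
qed

lemma matrix_vector_mult_gram:
  fixes P :: "'n::finite \<Rightarrow> 'b::real_inner"
  shows "(\<chi> i j. P i \<bullet> P j) *v a = (\<chi> i. P i \<bullet> (\<Sum>k\<in>UNIV. a $ k *\<^sub>R P k))"
  by (simp add: matrix_vector_mult_def inner_sum_right mult.commute)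

text \<open>A kernel vector gives a combination of the \<open>P k\<close> orthogonal to each
  \<open>P i\<close>, hence to itself. It is therefore zero, and injectivity makes its coefficients
  zero.\<close>

lemma det_gram_nonzero:
  fixes P :: "'n::finite \<Rightarrow> 'b::real_inner"
  assumes "inj (\<lambda>a :: real^'n. \<Sum>k\<in>UNIV. a $ k *\<^sub>R P k)"
  shows "det (\<chi> i j. P i \<bullet> P j) \<noteq> 0"
proof -
  have "a = 0" if "(\<chi> i j. P i \<bullet> P j) *v a = 0" for a
  proof -
    let ?u = "\<Sum>k\<in>UNIV. a $ k *\<^sub>R P k"
    have "P i \<bullet> ?u = 0" for i
      using that by (simp add: matrix_vector_mult_gram vec_eq_iff)
    then have "?u \<bullet> ?u = 0"
      by (simp add: inner_sum_left)
    then show "a = 0"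
      using injD[OF assms, of a 0] by simp
  qed
  then show ?thesis
    by (simp add: invertible_det_nz[symmetric] invertible_left_inverse matrix_left_invertible_ker)
qed

text \<open>This is where codimension one enters: the coefficient map \<phi> of the frame together
  with \<nu> is injective between spaces of equal dimension, hence onto. So \<open>u\<close> is a
  combination of vectors orthogonal to it.\<close>

lemma orthogonal_frame_eq_0:
  fixes P :: "'n::finite \<Rightarrow> 'b::euclidean_space"
  assumes dim: "DIM('b) = CARD('n) + 1"
    and inj: "inj (\<lambda>a :: real^'n. \<Sum>k\<in>UNIV. a $ k *\<^sub>R P k)"
    and \<nu>: "norm \<nu> = 1" "\<And>i. P i \<bullet> \<nu> = 0"
    and u: "u \<bullet> \<nu> = 0" "\<And>i. u \<bullet> P i = 0"
  shows "u = 0"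
proof -
  define \<phi> :: "(real^'n) \<times> real \<Rightarrow> 'b" where "\<phi> = (\<lambda>(a, r). (\<Sum>k\<in>UNIV. a $ k *\<^sub>R P k) + r *\<^sub>R \<nu>)"
  have lin: "linear \<phi>"
    by (rule linearI)
      (auto simp: \<phi>_def scaleR_add_left sum.distrib scaleR_sum_right scaleR_add_right)
  have "z = 0" if "\<phi> z = 0" for z
  proof -
    obtain a r where z: "z = (a, r)" by (cases z)
    have "\<phi> z \<bullet> \<nu> = r"
      using \<nu> by (simp add: \<phi>_def z inner_add_left inner_sum_left norm_eq_1)
    with that have "r = 0" by simp
    with that have "a = 0"
      using injD[OF inj, of a 0] by (simp add: \<phi>_def z)
    with \<open>r = 0\<close> z show "z = 0" by (simp add: zero_prod_def)
  qed
  then have "inj \<phi>"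
    by (simp add: linear_injective_0[OF lin])
  then have "surj \<phi>"
    by (rule eucl.linear_injective_imp_surjective[OF lin]) (simp add: dim)
  then obtain z where "u = \<phi> z" by blast
  then have "u = (\<Sum>k\<in>UNIV. fst z $ k *\<^sub>R P k) + snd z *\<^sub>R \<nu>"
    by (simp add: \<phi>_def case_prod_unfold)
  then have "u \<bullet> u = u \<bullet> ((\<Sum>k\<in>UNIV. fst z $ k *\<^sub>R P k) + snd z *\<^sub>R \<nu>)"
    by simp
  also have "\<dots> = 0"
    using u by (simp add: inner_add_right inner_sum_right)
  finally show ?thesis by simp
qed

lemma inner_frame_expansion:
  fixes P :: "'n::finite \<Rightarrow> 'b::euclidean_space"
  assumes dim: "DIM('b) = CARD('n) + 1"
    and inj: "inj (\<lambda>a :: real^'n. \<Sum>k\<in>UNIV. a $ k *\<^sub>R P k)"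
    and \<nu>: "norm \<nu> = 1" "\<And>i. P i \<bullet> \<nu> = 0"
  defines "G \<equiv> \<chi> i j. P i \<bullet> P j"
  shows "v \<bullet> w = (v \<bullet> \<nu>) * (w \<bullet> \<nu>) +
    (\<Sum>k\<in>UNIV. \<Sum>l\<in>UNIV. matrix_inv G $ k $ l * (w \<bullet> P l) * (v \<bullet> P k))"
proof -
  \<comment> \<open>The coefficients of the tangential projection of \<open>w\<close>, obtained by
    solving the normal equations with the Gram matrix; \<open>u\<close> is the remainder, to be
    shown zero.\<close>
  define a where "a = matrix_inv G *v (\<chi> l. w \<bullet> P l)"
  define u where "u = w - (w \<bullet> \<nu>) *\<^sub>R \<nu> - (\<Sum>k\<in>UNIV. a $ k *\<^sub>R P k)"
  have "G *v a = (\<chi> l. w \<bullet> P l)"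
    using matrix_inv(1)[OF det_gram_nonzero[OF inj]]
    by (simp add: a_def G_def matrix_vector_mul_assoc)
  then have "P i \<bullet> (\<Sum>k\<in>UNIV. a $ k *\<^sub>R P k) = w \<bullet> P i" for i
    unfolding G_def matrix_vector_mult_gram by (simp add: vec_eq_iff)
  then have "u \<bullet> P i = 0" for i
    using \<nu>(2)[of i] by (simp add: u_def inner_diff_right inner_commute[of _ "P i"])
  moreover have "u \<bullet> \<nu> = 0"
    using \<nu> by (simp add: u_def inner_diff_left inner_sum_left norm_eq_1)
  ultimately have "u = 0"
    by (intro orthogonal_frame_eq_0[OF dim inj \<nu>])
  then have "w = (w \<bullet> \<nu>) *\<^sub>R \<nu> + (\<Sum>k\<in>UNIV. a $ k *\<^sub>R P k)"
    by (simp add: u_def algebra_simps)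
  then have "v \<bullet> w = v \<bullet> ((w \<bullet> \<nu>) *\<^sub>R \<nu> + (\<Sum>k\<in>UNIV. a $ k *\<^sub>R P k))"
    by (rule arg_cong)
  then show ?thesis
    by (simp add: inner_add_right inner_sum_right a_def matrix_vector_mult_def sum_distrib_right)
qed


section \<open>Hypersurfaces in a chart\<close>

lemma pd_const_on_domain:
  assumes "is_chart M c" "p \<in> domain c" "\<And>q. q \<in> domain c \<Longrightarrow> f q = k"
  shows "pd c i f p = 0"
proof -
  have "(f \<circ> parametrization c has_derivative (\<lambda>_. 0)) (at (coords c p))"
  proof (rule has_derivative_transform_within_open[OF has_derivative_const[of k]])
    show "open (coords c ` domain c)" "coords c p \<in> coords c ` domain c"
      using assms(1,2) by (simp_all add: is_chart_open)
    show "k = (f \<circ> parametrization c) x" if "x \<in> coords c ` domain c" for x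
      using assms(3)[OF inv_into_into[OF that]] by simp
  qed
  from frechet_derivative_at[OF this, symmetric] show ?thesis
    by (simp add: pd_def)
qed

lemma pd_inner:
  fixes f g :: "'m \<Rightarrow> 'b::real_inner" and c :: "('m, 'n::finite) chart"
  assumes "is_chart M c" "p \<in> domain c"
    and "(f \<circ> parametrization c) differentiable (at (coords c p))"
    and "(g \<circ> parametrization c) differentiable (at (coords c p))"
  shows "pd c i (\<lambda>q. f q \<bullet> g q) p = pd c i f p \<bullet> g p + f p \<bullet> pd c i g p"
proof -
  have "((\<lambda>x. (f \<circ> parametrization c) x \<bullet> (g \<circ> parametrization c) x) has_derivative
      (\<lambda>h. (f \<circ> parametrization c) (coords c p) \<bullet>
             frechet_derivative (g \<circ> parametrization c) (at (coords c p)) h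
         + frechet_derivative (f \<circ> parametrization c) (at (coords c p)) h \<bullet>
             (g \<circ> parametrization c) (coords c p))) (at (coords c p))"
    by (intro has_derivative_inner assms(3,4)[unfolded frechet_derivative_works])
  from fun_cong[OF frechet_derivative_at[OF this], of "axis i 1"] show ?thesis
    using assms(1,2) by (simp add: pd_def comp_def)
qed

text \<open>Translates the immersion condition, injectivity of the differential, into linear
  independence of the coordinate frame.\<close>

lemma frechet_derivative_eq_sum_pd:
  fixes c :: "('m, 'n::finite) chart"
  assumes "(f \<circ> parametrization c) differentiable (at (coords c p))"
  shows "frechet_derivative (f \<circ> parametrization c) (at (coords c p)) a
    = (\<Sum>i\<in>UNIV. a $ i *\<^sub>R pd c i f p)"
proof -
  let ?L = "frechet_derivative (f \<circ> parametrization c) (at (coords c p))"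
  have lin: "linear ?L"
    using assms by (simp add: linear_frechet_derivative)
  have "?L a = ?L (\<Sum>i\<in>UNIV. a $ i *\<^sub>R axis i 1)"
    using basis_expansion[of a] by (simp add: scalar_mult_eq_scaleR)
  then show ?thesis
    by (simp add: pd_def linear_sum[OF lin] linear_scale[OF lin])
qed

text \<open>For an induced metric the product rule expands the three derivatives of g into six
  terms. Symmetry of second derivatives cancels four of them and merges the other two into 2 <f_ij,
  f_l>, whose factor absorbs the 1/2 of the definition.\<close>

lemma christoffel_eq:
  fixes f :: "'m \<Rightarrow> real^'N::finite" and c :: "('m, 'n::finite) chart"
  assumes c: "is_chart M c" "p \<in> domain c"
    and df: "\<And>j. (pd c j f \<circ> parametrization c) differentiable (at (coords c p))"
    and sym: "\<And>i j. pd c i (pd c j f) p = pd c j (pd c i f) p"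
  shows "christoffel c f k i j p =
    (\<Sum>l\<in>UNIV. metric_inv c f p $ k $ l * (pd c i (pd c j f) p \<bullet> pd c l f p))"
proof -
  have dg: "pd c i (\<lambda>q. metric c f q $ j $ l) p =
      pd c i (pd c j f) p \<bullet> pd c l f p + pd c j f p \<bullet> pd c i (pd c l f) p" for i j l
    using pd_inner[OF c df df] by (simp add: metric_def)
  have "pd c i (\<lambda>q. metric c f q $ j $ l) p + pd c j (\<lambda>q. metric c f q $ i $ l) p
      - pd c l (\<lambda>q. metric c f q $ i $ j) p = 2 * (pd c i (pd c j f) p \<bullet> pd c l f p)" for l
    unfolding dg using sym[of i j] sym[of i l] sym[of j l] by (simp add: inner_commute)
  then show ?thesis
    unfolding christoffel_def by (simp add: sum_distrib_left)
qed

text \<open>By the Gauss formula the Christoffel symbols cancel the tangential part of the second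
  derivatives of \<open>f\<close>; only their normal part, the second fundamental form, survives.\<close>

lemma d_dagger_tangential_part:
  fixes f \<nu> V :: "'m \<Rightarrow> real^'N::finite" and c :: "('m, 'n::finite) chart"
  assumes c: "is_chart M c" "p \<in> domain c" and dim: "CARD('N) = CARD('n) + 1"
    and df: "\<And>j. (pd c j f \<circ> parametrization c) differentiable (at (coords c p))"
    and d\<nu>: "(\<nu> \<circ> parametrization c) differentiable (at (coords c p))"
    and dV: "(V \<circ> parametrization c) differentiable (at (coords c p))"
    and sym: "\<And>i j. pd c i (pd c j f) p = pd c j (pd c i f) p"
    and inj: "inj (\<lambda>a :: real^'n. \<Sum>k\<in>UNIV. a $ k *\<^sub>R pd c k f p)"
    and unit: "norm (\<nu> p) = 1"
    and orth: "\<And>q i. q \<in> domain c \<Longrightarrow> pd c i f q \<bullet> \<nu> q = 0"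
  shows "d_dagger c f (\<lambda>q. \<chi> j. V q \<bullet> pd c j f q) p =
    (\<Sum>i\<in>UNIV. \<Sum>j\<in>UNIV. metric_inv c f p $ i $ j * (pd c i V p \<bullet> pd c j f p))
    + (V p \<bullet> \<nu> p) * mean_curvature c f \<nu> p"
proof -
  \<comment> \<open>The relation <f_i, \<nu>> = 0 holds on the whole chart domain, so it may be
    differentiated along x^j. This moves the derivative from \<nu> to f_i with a change of
    sign.\<close>
  have second_ff: "pd c i (pd c j f) p \<bullet> \<nu> p = second_ff c f \<nu> p $ i $ j" for i j
  proof -
    have "pd c j (\<lambda>q. pd c i f q \<bullet> \<nu> q) p = 0"
      by (rule pd_const_on_domain[OF c orth])
    then have "pd c j (pd c i f) p \<bullet> \<nu> p + pd c i f p \<bullet> pd c j \<nu> p = 0"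
      by (simp add: pd_inner[OF c df d\<nu>])
    then show ?thesis
      unfolding second_ff_def vec_lambda_beta sym[of i j] by linarith
  qed
  have cov: "cov_deriv c f (\<lambda>q. \<chi> j. V q \<bullet> pd c j f q) i j p =
      pd c i V p \<bullet> pd c j f p + (V p \<bullet> \<nu> p) * second_ff c f \<nu> p $ i $ j" for i j
  proof -
    have "V p \<bullet> pd c i (pd c j f) p =
        (V p \<bullet> \<nu> p) * second_ff c f \<nu> p $ i $ j
        + (\<Sum>k\<in>UNIV. christoffel c f k i j p * (V p \<bullet> pd c k f p))"
      unfolding inner_frame_expansion[of "\<lambda>k. pd c k f p" "\<nu> p" "V p" "pd c i (pd c j f) p",
          unfolded DIM_cart DIM_real mult_1_right, OF dim inj unit orth[OF c(2)]]
      by (simp add: second_ff christoffel_eq[OF c df sym] metric_inv_def metric_def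
          sum_distrib_right)
    then show ?thesis
      by (simp add: cov_deriv_def pd_inner[OF c dV df])
  qed
  show ?thesis
    unfolding d_dagger_def mean_curvature_def cov
    by (simp add: distrib_left sum.distrib sum_distrib_left mult_ac)
qed

text \<open>The rate of the metric has two halves that are transposes of each other; they contribute
  equally because the inverse metric is symmetric. The resulting 2 meets the 1/2 from the square
  root in the volume density.\<close>

lemma trace_metric_derivative:
  fixes f V :: "'m \<Rightarrow> real^'N::finite" and c :: "('m, 'n::finite) chart"
  assumes "det (metric c f p) \<noteq> 0"
  shows "trace ((\<chi> i j. pd c i V p \<bullet> pd c j f p + pd c i f p \<bullet> pd c j V p) ** metric_inv c f p) =
    2 * (\<Sum>i\<in>UNIV. \<Sum>j\<in>UNIV. metric_inv c f p $ i $ j * (pd c i V p \<bullet> pd c j f p))"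
proof -
  have "transpose (metric c f p) = metric c f p"
    by (simp add: metric_def transpose_def inner_commute)
  then have "transpose (metric_inv c f p) = metric_inv c f p"
    unfolding metric_inv_def by (rule transpose_matrix_inv_symmetric[OF assms])
  then have "transpose (metric_inv c f p) $ i $ j = metric_inv c f p $ i $ j" for i j
    by (rule arg_cong)
  then have sym: "metric_inv c f p $ i $ j = metric_inv c f p $ j $ i" for i j
    unfolding transpose_def vec_lambda_beta .
  let ?A = "\<lambda>i j. metric_inv c f p $ i $ j * (pd c i V p \<bullet> pd c j f p)"
  have "trace ((\<chi> i j. pd c i V p \<bullet> pd c j f p + pd c i f p \<bullet> pd c j V p) ** metric_inv c f p) =
      (\<Sum>i\<in>UNIV. \<Sum>j\<in>UNIV. ?A i j + ?A j i)"
    unfolding trace_def matrix_matrix_mult_def vec_lambda_beta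
  proof (intro sum.cong refl)
    show "(pd c i V p \<bullet> pd c j f p + pd c i f p \<bullet> pd c j V p) * metric_inv c f p $ j $ i
        = ?A i j + ?A j i" for i j
      by (simp add: sym[of i j] algebra_simps inner_commute)
  qed
  also have "\<dots> = (\<Sum>i\<in>UNIV. \<Sum>j\<in>UNIV. ?A i j) + (\<Sum>i\<in>UNIV. \<Sum>j\<in>UNIV. ?A j i)"
    by (simp add: sum.distrib)
  also have "(\<Sum>i\<in>UNIV. \<Sum>j\<in>UNIV. ?A j i) = (\<Sum>i\<in>UNIV. \<Sum>j\<in>UNIV. ?A i j)"
    by (rule sum.swap)
  finally show ?thesis by simp
qed

text \<open>Lowering an index undoes raising it. Applied to the raised S and the raised gradient of
  e, it reads off the covariant components of the acceleration.\<close>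

lemma sum_raise_inner:
  fixes f :: "'m \<Rightarrow> real^'N::finite" and c :: "('m, 'n::finite) chart"
  assumes "det (metric c f p) \<noteq> 0"
  shows "(\<Sum>k\<in>UNIV. raise c f p \<omega> $ k *\<^sub>R pd c k f p) \<bullet> pd c i f p = \<omega> $ i"
proof -
  have "metric c f p *v raise c f p \<omega> = \<omega>"
    using matrix_inv(1)[OF assms]
    by (simp add: raise_def metric_inv_def matrix_vector_mul_assoc)
  then show ?thesis
    unfolding metric_def matrix_vector_mult_gram by (simp add: vec_eq_iff inner_commute)
qed

lemma pd_energy_density:
  fixes F :: "real \<Rightarrow> 'm \<Rightarrow> real^'N::finite" and c :: "('m, 'n::finite) chart"
  assumes c: "is_chart M c" "p \<in> domain c"
    and dV: "(velocity T F t \<circ> parametrization c) differentiable (at (coords c p))"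
  shows "pd c i (energy_density n T F t) p = velocity T F t p \<bullet> pd c i (velocity T F t) p"
proof -
  let ?V = "velocity T F t \<circ> parametrization c"
  let ?L = "frechet_derivative ?V (at (coords c p))"
  have "((\<lambda>x. 1/2 * (?V x \<bullet> ?V x + real n)) has_derivative
      (\<lambda>h. 1/2 * (?V (coords c p) \<bullet> ?L h + ?L h \<bullet> ?V (coords c p)))) (at (coords c p))"
    by (intro has_derivative_mult_right has_derivative_add_const has_derivative_inner
        dV[unfolded frechet_derivative_works])
  from fun_cong[OF frechet_derivative_at[OF this], of "axis i 1"] show ?thesis
    using c by (simp add: pd_def comp_def energy_density_def power2_norm_eq_inner inner_commute)
qed

theorem proposition4p4:
  fixes M :: "'m topology"
    and A Or :: "('m, 'n::finite) chart set"
    and T :: ereal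
    and F \<nu> :: "real \<Rightarrow> 'm \<Rightarrow> real ^ 'N::finite"
    and X :: "'m \<Rightarrow> ('m, 'n) tangent"
  assumes "smooth_manifold M A"
    and "orientation M A Or"
    and "CARD('N) = CARD('n) + 1"
    and "0 < T"
    and "Ck_family 2 M A T F"
    and "immersions M A T F"
    and "unit_normal M A T F \<nu>"
    and "HMCF M A T F \<nu>"
    and "smooth_vector_field M A X"
  shows "\<forall>t\<in>time_span T. \<forall>c\<in>Or. \<forall>p\<in>domain c. \<forall>w. (\<forall>j. tangent_vector M A p (w j)) \<longrightarrow>
           ((\<lambda>s. S_eval c T F s p (X p) * volume_form c (F s) p w) has_real_derivative 0)
             (at t within time_span T)"
proof (intro ballI allI impI)
  fix t c p w
  assume t: "t \<in> time_span T" and "c \<in> Or" and p: "p \<in> domain c"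
  have c: "c \<in> smooth_charts M A"
    using assms(2) \<open>c \<in> Or\<close> by (auto simp: orientation_def)
  then have chart: "is_chart M c"
    by (simp add: smooth_charts_def)
  have F: "Ck_chart (Suc (Suc 0)) c T F"
    using assms(5) c by (simp add: Ck_family_def numeral_2_eq_2)
  have V: "Ck_chart (Suc 0) c T (velocity T F)"
    using Ck_chart_dt[OF F chart] by (simp only: velocity_def)
  have \<nu>: "Ck_chart (Suc 0) c T \<nu>"
    using assms(7) c by (simp add: unit_normal_def Ck_family_def)
  note dV = Ck_chart_differentiable[OF V chart t p]
  note dF = Ck_chart_differentiable[OF F chart t p]
  define P where "P i = pd c i (F t) p" for i
  define W where "W i = pd c i (velocity T F t) p" for i
  define v where "v = velocity T F t p"
  define S where "S = tangential_velocity c T F t"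
  define \<kappa> where "\<kappa> =
    normal_speed T F \<nu> t p * mean_curvature c (F t) (\<nu> t) p - d_dagger c (F t) S p"
  have S_eq: "S = (\<lambda>q. \<chi> j. velocity T F t q \<bullet> pd c j (F t) q)"
    by (simp add: S_def tangential_velocity_def fun_eq_iff)
  have "p \<in> topspace M"
    using chart p openin_subset unfolding is_chart_def by blast
  then have unit: "norm (\<nu> t p) = 1"
    using assms(7) t by (simp add: unit_normal_def)
  have orth: "pd c i (F t) q \<bullet> \<nu> t q = 0" if "q \<in> domain c" for q i
    using assms(7) t c that by (simp add: unit_normal_def)
  have inj: "inj (\<lambda>a :: real^'n. \<Sum>k\<in>UNIV. a $ k *\<^sub>R pd c k (F t) p)"
  proof -
    have "frechet_derivative (F t \<circ> parametrization c) (at (coords c p)) =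
        (\<lambda>a. \<Sum>k\<in>UNIV. a $ k *\<^sub>R pd c k (F t) p)"
      by (rule ext) (rule frechet_derivative_eq_sum_pd[OF dF])
    moreover have "inj (frechet_derivative (F t \<circ> parametrization c) (at (coords c p)))"
      using assms(6) t c p unfolding immersions_def by blast
    ultimately show ?thesis
      by (simp only:)
  qed
  have det: "det (metric c (F t) p) \<noteq> 0"
    using det_gram_nonzero[OF inj] by (simp add: metric_def)

  have div_S: "d_dagger c (F t) S p =
      (\<Sum>i\<in>UNIV. \<Sum>j\<in>UNIV. metric_inv c (F t) p $ i $ j * (W i \<bullet> P j))
      + normal_speed T F \<nu> t p * mean_curvature c (F t) (\<nu> t) p"
    unfolding S_eq W_def P_def normal_speed_def
    by (rule d_dagger_tangential_part[OF chart p assms(3)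
          Ck_chart_differentiable[OF Ck_chart_pd[OF F chart] chart t p]
          Ck_chart_differentiable[OF \<nu> chart t p] dV pd_commute[OF F chart t p] inj unit orth])

  have P': "((\<lambda>s. pd c i (F s) p) has_vector_derivative W i) (at t within time_span T)" for i
    using has_vector_derivative_pd_commute[OF F chart t p, of i]
    by (simp add: W_def velocity_def[abs_def])
  have v': "((\<lambda>s. velocity T F s p) has_vector_derivative dt T (\<lambda>s. velocity T F s p) t)
      (at t within time_span T)"
    by (rule has_vector_derivative_dt[OF V chart t p])
  have acceleration: "dt T (\<lambda>s. velocity T F s p) t \<bullet> P i + v \<bullet> W i = \<kappa> * (v \<bullet> P i)" for i
  proof -
    define S_sharp where "S_sharp = raise c (F t) p (S p)"
    define grad where "grad = raise c (F t) p (\<chi> i. pd c i (energy_density CARD('n) T F t) p)"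
    define r where "r = (energy_density CARD('n) T F t p - S p \<bullet> S_sharp)
        * mean_curvature c (F t) (\<nu> t) p - normal_speed T F \<nu> t p * d_dagger c (F t) S p"
    have "dt T (\<lambda>s. velocity T F s p) t = r *\<^sub>R \<nu> t p
        + (\<Sum>k\<in>UNIV. (\<kappa> * S_sharp $ k - grad $ k) *\<^sub>R P k)"
      unfolding r_def \<kappa>_def S_sharp_def grad_def P_def S_def
      by (rule bspec[OF bspec[OF bspec[OF assms(8)[unfolded HMCF_def Let_def] t] c] p])
    \<comment> \<open>The tangential sum is separated into a multiple of the raised S and the raised
      gradient, so that index lowering applies to each.\<close>
    also have "\<dots> = r *\<^sub>R \<nu> t p + (\<kappa> *\<^sub>R (\<Sum>k\<in>UNIV. S_sharp $ k *\<^sub>R P k)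
        - (\<Sum>k\<in>UNIV. grad $ k *\<^sub>R P k))"
      by (simp add: scaleR_diff_left sum_subtractf scaleR_sum_right)
    finally have "dt T (\<lambda>s. velocity T F s p) t \<bullet> P i = \<kappa> * (S p $ i)
        - pd c i (energy_density CARD('n) T F t) p"
      using orth[OF p, of i]
      by (simp add: inner_add_left inner_diff_left S_sharp_def grad_def P_def
          sum_raise_inner[OF det] inner_commute[of "\<nu> t p"])
    then show ?thesis
      by (simp add: pd_energy_density[OF chart p dV] S_eq v_def W_def P_def)
  qed

  have "((\<lambda>s. velocity T F s p \<bullet> pd c i (F s) p) has_real_derivative \<kappa> * (v \<bullet> P i))
      (at t within time_span T)" for i
  proof -
    have "((\<lambda>s. velocity T F s p \<bullet> pd c i (F s) p) has_vector_derivative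
        v \<bullet> W i + dt T (\<lambda>s. velocity T F s p) t \<bullet> P i) (at t within time_span T)"
      unfolding v_def P_def
      by (rule bounded_bilinear.has_vector_derivative[OF bounded_bilinear_inner v' P'])
    then show ?thesis
      using acceleration[of i] by (simp add: has_real_derivative_iff_has_vector_derivative add.commute)
  qed
  \<comment> \<open>The chart components of \<open>X p\<close> do not depend on time, and all S_i
    have the same rate \<kappa>; by linearity S(X) has it as well.\<close>
  then have S': "((\<lambda>s. S_eval c T F s p (X p)) has_real_derivative \<kappa> * S_eval c T F t p (X p))
      (at t within time_span T)"
    unfolding S_eval_def tangential_velocity_def vec_lambda_beta sum_distrib_left v_def P_def
      mult.assoc[symmetric]
    by (intro DERIV_sum DERIV_cmult_right)

  have "((\<lambda>s. metric c (F s) p $ i $ j) has_real_derivative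
      (\<chi> i j. W i \<bullet> P j + P i \<bullet> W j) $ i $ j) (at t within time_span T)" for i j
  proof -
    have "((\<lambda>s. pd c i (F s) p \<bullet> pd c j (F s) p) has_vector_derivative
        P i \<bullet> W j + W i \<bullet> P j) (at t within time_span T)"
      unfolding P_def
      by (rule bounded_bilinear.has_vector_derivative[OF bounded_bilinear_inner P' P'])
    then show ?thesis
      by (simp add: metric_def has_real_derivative_iff_has_vector_derivative add.commute)
  qed
  \<comment> \<open>After the factors 2 and 1/2 cancel, the rate is the contraction of <W_i, P_j>
    with the inverse metric, and \<open>div_S\<close> solved for this contraction gives
    -\<kappa>.\<close>
  from has_real_derivative_sqrt_det[OF this det]
  have "((\<lambda>s. sqrt (det (metric c (F s) p))) has_real_derivative
      - \<kappa> * sqrt (det (metric c (F t) p))) (at t within time_span T)"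
    using trace_metric_derivative[OF det, of "velocity T F t"] div_S
    by (simp add: metric_inv_def[symmetric] W_def P_def \<kappa>_def mult.commute)
  \<comment> \<open>Tested on fixed tangent vectors \<open>w\<close>, the time-dependent n-form
    becomes a real function of time, in which the determinant of the components of \<open>w\<close>
    is a constant factor.\<close>
  then have "((\<lambda>s. volume_form c (F s) p w) has_real_derivative - \<kappa> * volume_form c (F t) p w)
      (at t within time_span T)"
    unfolding volume_form_def mult.assoc[symmetric] by (rule DERIV_cmult_right)
  from DERIV_mult[OF S' this]
  show "((\<lambda>s. S_eval c T F s p (X p) * volume_form c (F s) p w) has_real_derivative 0)
      (at t within time_span T)"
    by (simp add: algebra_simps)
qed

end
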